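(* Let $m>0$ and consider the $c=0$ limit of the one-centre Kastor-Traschen metric, $g=-\frac{dT^2}{V^2}+V^2\,|d\mathbf{x}|^2$ with $V(\mathbf{x})=\frac{m}{|\mathbf{x}|}$ on $\mathbb{R}\times(\mathbb{R}^3\setminus\{0\})$. Then the projection $\mathbf{x}(s)$ to the space of orbits of $\partial/\partial T$ of any null geodesic of $g$, parametrised by Euclidean arc length ($|\dot{\mathbf{x}}|=1$), satisfies $$\dddot{\mathbf{x}}=-|\ddot{\mathbf{x}}|^2\,\dot{\mathbf{x}},$$ i.e. it is a conformal circle of the flat metric on $\mathbb{R}^3$.
   Context: Norms are Euclidean and dots denote $d/ds$. A null geodesic is regarded as an unparametrised curve, reparametrised by the Euclidean arc length $s$ of its spatial part. The conformal circles of the flat metric on $\mathbb{R}^3$ are, by definition, the arc-length parametrised curves satisfying $\dddot{\mathbf{x}}=-|\ddot{\mathbf{x}}|^2\dot{\mathbf{x}}$. *)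

theory Defs
  imports "HOL-Analysis.Analysis"
begin

section \<open>Geodesics of a metric given in global coordinates\<close>

text \<open>
  A (pseudo-Riemannian) metric on an open set of coordinate space is given by its matrix of
  components \<open>G p $ i $ j\<close> at the point \<open>p\<close>.
\<close>

definition partial :: "'n::finite \<Rightarrow> (real ^ 'n \<Rightarrow> real) \<Rightarrow> real ^ 'n \<Rightarrow> real" where
  "partial k f p = frechet_derivative f (at p) (axis k 1)"

definition christoffel ::
  "(real ^ 'n \<Rightarrow> real ^ 'n ^ 'n) \<Rightarrow> real ^ 'n \<Rightarrow> 'n::finite \<Rightarrow> 'n \<Rightarrow> 'n \<Rightarrow> real" where
  "christoffel G p k i j =
     (\<Sum>l\<in>UNIV. matrix_inv (G p) $ k $ l *
        (partial i (\<lambda>q. G q $ j $ l) p + partial j (\<lambda>q. G q $ i $ l) p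
          - partial l (\<lambda>q. G q $ i $ j) p)) / 2"

text \<open>Affinely parametrised geodesics, with parameter ranging over an open interval \<open>J\<close>.\<close>

definition geodesic_on ::
  "(real ^ 'n \<Rightarrow> real ^ 'n ^ 'n) \<Rightarrow> (real ^ 'n) set \<Rightarrow> real set \<Rightarrow> (real \<Rightarrow> real ^ 'n::finite) \<Rightarrow> bool" where
  "geodesic_on G U J \<eta> \<longleftrightarrow> open J \<and> is_interval J \<and> \<eta> ` J \<subseteq> U \<and>
     (\<exists>v a. \<forall>t\<in>J. (\<eta> has_vector_derivative v t) (at t) \<and>
                  (v has_vector_derivative a t) (at t) \<and>
                  (\<forall>k. a t $ k +
                     (\<Sum>i\<in>UNIV. \<Sum>j\<in>UNIV. christoffel G (\<eta> t) k i j * v t $ i * v t $ j) = 0))"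

definition null_geodesic_on ::
  "(real ^ 'n \<Rightarrow> real ^ 'n ^ 'n) \<Rightarrow> (real ^ 'n) set \<Rightarrow> real set \<Rightarrow> (real \<Rightarrow> real ^ 'n::finite) \<Rightarrow> bool" where
  "null_geodesic_on G U J \<eta> \<longleftrightarrow> geodesic_on G U J \<eta> \<and>
     (\<forall>t\<in>J. let v = vector_derivative \<eta> (at t) in v \<noteq> 0 \<and> v \<bullet> (G (\<eta> t) *v v) = 0)"

text \<open>
  Null geodesics as unparametrised curves: \<open>\<gamma>\<close> is some regular reparametrisation, on the open
  interval \<open>I\<close>, of an affinely parametrised null geodesic. Since the derivative of \<open>\<phi>\<close> never
  vanishes, \<open>\<phi>\<close> is automatically injective on \<open>I\<close>; it may reverse the orientation.
\<close>

definition unparam_null_geodesic_on ::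
  "(real ^ 'n \<Rightarrow> real ^ 'n ^ 'n) \<Rightarrow> (real ^ 'n) set \<Rightarrow> real set \<Rightarrow> (real \<Rightarrow> real ^ 'n::finite) \<Rightarrow> bool" where
  "unparam_null_geodesic_on G U I \<gamma> \<longleftrightarrow> open I \<and> is_interval I \<and>
     (\<exists>J \<eta> \<phi>. null_geodesic_on G U J \<eta> \<and> \<phi> ` I = J \<and>
        (\<forall>s\<in>I. \<phi> differentiable (at s) \<and> deriv \<phi> s \<noteq> 0 \<and> \<gamma> s = \<eta> (\<phi> s)))"


section \<open>Arc length and conformal circles of Euclidean space\<close>

definition arc_length_param_on :: "real set \<Rightarrow> (real \<Rightarrow> real ^ 3) \<Rightarrow> bool" where
  "arc_length_param_on I x \<longleftrightarrow>
     (\<forall>s\<in>I. x differentiable (at s) \<and> norm (vector_derivative x (at s)) = 1)"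

definition conformal_circle_on :: "real set \<Rightarrow> (real \<Rightarrow> real ^ 3) \<Rightarrow> bool" where
  "conformal_circle_on I x \<longleftrightarrow> arc_length_param_on I x \<and>
     (\<exists>x1 x2 x3. \<forall>s\<in>I. (x has_vector_derivative x1 s) (at s) \<and>
                       (x1 has_vector_derivative x2 s) (at s) \<and>
                       (x2 has_vector_derivative x3 s) (at s) \<and>
                       x3 s = - ((norm (x2 s))\<^sup>2 *\<^sub>R x1 s))"


section \<open>The one-centre Kastor-Traschen metric with \<open>c = 0\<close>\<close>

text \<open>
  Coordinates on \<open>\<real> \<times> \<real>\<^sup>3\<close> are indexed by \<open>3 option\<close>: \<open>None\<close> is the index of \<open>T\<close> and
  \<open>Some i\<close> that of \<open>x\<^sub>i\<close>. The orbits of \<open>\<partial>/\<partial>T\<close> are the fibres of \<open>spatial\<close>, which is thus the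
  projection to the space of orbits.
\<close>

type_synonym spacetime = "real ^ (3 option)"

definition spatial :: "spacetime \<Rightarrow> real ^ 3" where
  "spatial p = (\<chi> i. p $ Some i)"

definition kt_domain :: "spacetime set" where
  "kt_domain = {p. spatial p \<noteq> 0}"

definition kt_V :: "real \<Rightarrow> real ^ 3 \<Rightarrow> real" where
  "kt_V m x = m / norm x"

definition kt_metric :: "real \<Rightarrow> spacetime \<Rightarrow> real ^ (3 option) ^ (3 option)" where
  "kt_metric m p = (\<chi> a b. if a \<noteq> b then 0 else
     (case a of None \<Rightarrow> - (1 / (kt_V m (spatial p))\<^sup>2)
              | Some i \<Rightarrow> (kt_V m (spatial p))\<^sup>2))"

end

theory Submission
  imports Defs
begin

text \<open>
  With \<open>r = |x|\<close>, the null condition gives \<open>T'\<^sup>2 = m\<^sup>4 |x'|\<^sup>2 / r\<^sup>4\<close>, which removes \<open>T\<close> from the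
  spatial geodesic equations and leaves, in the affine parameter,
  \<open>x'' = 2 (x \<bullet> x') / r\<^sup>2 x' - 2 |x'|\<^sup>2 / r\<^sup>2 x\<close>. This flow preserves \<open>|x'|\<^sup>2 = c\<close>, and differentiating
  once more gives \<open>x''' = - |x''|\<^sup>2 / c x'\<close>. A reparametrisation \<open>\<phi>\<close> by arc length satisfies
  \<open>\<phi>'\<^sup>2 c = 1\<close>; hence \<open>\<phi>'\<close> is constant by Darboux's theorem, and the equation rescales to that of
  a conformal circle.
\<close>

section \<open>Christoffel symbols of diagonal metrics\<close>

lemma sum_option_UNIV:
  fixes f :: "'a::finite option \<Rightarrow> 'b::comm_monoid_add"
  shows "(\<Sum>a\<in>UNIV. f a) = f None + (\<Sum>i\<in>UNIV. f (Some i))"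
  by (simp add: UNIV_option_conv sum.reindex)

text \<open>\<open>matrix_inv\<close> is a Hilbert choice. The explicit two-sided inverse
  \<open>?B\<close> shows that the chosen matrix is an inverse too, and uniqueness of inverses
  identifies the two.\<close>

lemma matrix_inv_diagonal:
  fixes d :: "'n::finite \<Rightarrow> real"
  assumes "\<And>a. d a \<noteq> 0"
  shows "matrix_inv (\<chi> a b. if a = b then d a else 0) = (\<chi> a b. if a = b then 1 / d a else 0)"
    (is "matrix_inv ?A = ?B")
proof -
  have AB: "?A ** ?B = mat 1" and BA: "?B ** ?A = mat 1"
    by (vector matrix_matrix_mult_def mat_def,
        auto simp: if_distrib [where f = "\<lambda>x. x * _"] assms cong: if_cong)+
  then have "?A ** matrix_inv ?A = mat 1 \<and> matrix_inv ?A ** ?A = mat 1"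
    unfolding matrix_inv_def
    using someI [of "\<lambda>X. ?A ** X = mat 1 \<and> X ** ?A = mat 1" ?B] by blast
  then have "?B ** (?A ** matrix_inv ?A) = ?B"
    by (simp only: matrix_mul_rid)
  then show ?thesis
    by (simp only: matrix_mul_assoc BA matrix_mul_lid)
qed

lemma partial_eqI:
  assumes "(f has_derivative f') (at p)"
  shows "partial k f p = f' (axis k 1)"
  using frechet_derivative_at [OF assms] by (simp add: partial_def)

lemma partial_zero: "partial k (\<lambda>_. 0) p = 0"
  by (rule partial_eqI) simp

text \<open>The inverse metric is diagonal as well, so the sum over \<open>l\<close> collapses to
  \<open>l = k\<close>; a partial derivative survives only where its component lies on the
  diagonal.\<close>

lemma christoffel_diagonal:
  fixes D :: "'n::finite \<Rightarrow> real ^ 'n \<Rightarrow> real"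
  assumes G: "\<And>q. G q = (\<chi> a b. if a = b then D a q else 0)"
    and nz: "\<And>a. D a p \<noteq> 0"
  shows "christoffel G p k i j =
    ((if j = k then partial i (D k) p else 0) + (if i = k then partial j (D k) p else 0)
      - (if i = j then partial k (D i) p else 0)) / (2 * D k p)"
proof -
  have P: "partial c (\<lambda>q. G q $ a $ b) p = (if a = b then partial c (D a) p else 0)" for a b c
    by (simp add: G partial_zero)
  have I: "matrix_inv (G p) $ k $ l = (if k = l then 1 / D k p else 0)" for l
    by (simp add: G matrix_inv_diagonal nz)
  show ?thesis
    unfolding christoffel_def P I
    by (simp add: if_distrib [where f = "\<lambda>x. x * _"] nz cong: if_cong)
qed

text \<open>The first two terms of the symbol contribute equally, by symmetry in \<open>i\<close>
  and \<open>j\<close>, and the third only for \<open>i = j\<close>.\<close>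

lemma christoffel_diagonal_contraction:
  fixes D :: "'n::finite \<Rightarrow> real ^ 'n \<Rightarrow> real"
  assumes "\<And>q. G q = (\<chi> a b. if a = b then D a q else 0)"
    and "\<And>a. D a p \<noteq> 0"
  shows "(\<Sum>i\<in>UNIV. \<Sum>j\<in>UNIV. christoffel G p k i j * v $ i * v $ j) =
    (2 * v $ k * (\<Sum>i\<in>UNIV. partial i (D k) p * v $ i)
      - (\<Sum>i\<in>UNIV. partial k (D i) p * (v $ i)\<^sup>2)) / (2 * D k p)"
proof -
  have "christoffel G p k i j * v $ i * v $ j =
      ((if j = k then partial i (D k) p * v $ i * v $ k else 0)
       + (if i = k then partial j (D k) p * v $ j * v $ k else 0)
       - (if i = j then partial k (D i) p * (v $ i)\<^sup>2 else 0)) / (2 * D k p)" for i j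
    unfolding christoffel_diagonal [of G D, OF assms]
    by (auto simp: power2_eq_square algebra_simps add_divide_distrib diff_divide_distrib)
  moreover have "(\<Sum>i\<in>UNIV. \<Sum>j\<in>UNIV. if i = k then f j else 0) = (\<Sum>j\<in>UNIV. f j)"
    for f :: "'n \<Rightarrow> real"
    by (subst sum.swap) simp
  ultimately show ?thesis
    by (simp add: sum_divide_distrib [symmetric] sum.distrib sum_subtractf sum_distrib_left
        mult_ac)
qed

section \<open>The spatial geodesic equation of the Kastor-Traschen metric\<close>

text \<open>These are \<open>-1/V^2\<close> and \<open>V^2\<close>, written with inner products
  instead of norms so that they are rational in the coordinates.\<close>

definition kt_coeff :: "real \<Rightarrow> 3 option \<Rightarrow> spacetime \<Rightarrow> real" where
  "kt_coeff m a q = (case a of None \<Rightarrow> - ((spatial q \<bullet> spatial q) / m\<^sup>2)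
     | Some i \<Rightarrow> m\<^sup>2 / (spatial q \<bullet> spatial q))"

text \<open>
  Owing to \<open>x / 0 = 0\<close>, this holds even where \<open>spatial q = 0\<close>, so the components can be
  differentiated without restricting them to a neighbourhood.
\<close>

lemma kt_metric_diagonal:
  "kt_metric m q = (\<chi> a b. if a = b then kt_coeff m a q else 0)"
  by (auto simp: kt_metric_def kt_coeff_def kt_V_def vec_eq_iff power_divide power2_norm_eq_inner
      split: option.splits)

lemma bounded_linear_spatial: "bounded_linear spatial"
  unfolding linear_conv_bounded_linear [symmetric]
  by (rule linearI) (simp_all add: spatial_def vec_eq_iff)

lemma spatial_axis_None: "spatial (axis None 1) = 0"
  by (simp add: spatial_def vec_eq_iff axis_def)

lemma spatial_axis_Some: "spatial (axis (Some i) 1) = axis i 1"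
  by (auto simp: spatial_def vec_eq_iff axis_def)

text \<open>Since \<open>spatial (axis k 1)\<close> vanishes for \<open>k = None\<close>, one
  formula covers both the \<open>T\<close> derivative and the spatial ones.\<close>

lemma partial_kt_coeff:
  assumes "spatial p \<noteq> 0"
  shows "partial k (kt_coeff m None) p = - (2 * (spatial p \<bullet> spatial (axis k 1)) / m\<^sup>2)"
    and "partial k (kt_coeff m (Some i)) p =
      - (2 * m\<^sup>2 * (spatial p \<bullet> spatial (axis k 1)) / (spatial p \<bullet> spatial p)\<^sup>2)"
proof -
  note [derivative_intros] =
    bounded_linear.has_derivative [OF bounded_linear_spatial]
  have "((\<lambda>q. - ((spatial q \<bullet> spatial q) / m\<^sup>2)) has_derivative
      (\<lambda>h. - (2 * (spatial p \<bullet> spatial h) / m\<^sup>2))) (at p)"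
    by (auto intro!: derivative_eq_intros simp: inner_commute divide_inverse mult_ac)
  from partial_eqI [OF this]
  show "partial k (kt_coeff m None) p = - (2 * (spatial p \<bullet> spatial (axis k 1)) / m\<^sup>2)"
    by (simp add: kt_coeff_def [abs_def])
  have "((\<lambda>q. m\<^sup>2 / (spatial q \<bullet> spatial q)) has_derivative
      (\<lambda>h. - (2 * m\<^sup>2 * (spatial p \<bullet> spatial h) / (spatial p \<bullet> spatial p)\<^sup>2))) (at p)"
    using assms
    by (auto intro!: derivative_eq_intros simp: inner_commute power2_eq_square field_simps)
  from partial_eqI [OF this]
  show "partial k (kt_coeff m (Some i)) p =
      - (2 * m\<^sup>2 * (spatial p \<bullet> spatial (axis k 1)) / (spatial p \<bullet> spatial p)\<^sup>2)"
    by (simp add: kt_coeff_def [abs_def])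
qed

lemma sum_spatial_axis:
  "(\<Sum>i\<in>UNIV. (x \<bullet> spatial (axis i 1)) * v $ i) = x \<bullet> spatial v"
  by (simp add: sum_option_UNIV spatial_axis_None spatial_axis_Some inner_axis)
     (simp add: inner_vec_def spatial_def)

lemma inner_spatial_self: "spatial v \<bullet> spatial v = (\<Sum>i\<in>UNIV. (v $ Some i)\<^sup>2)"
  by (simp add: inner_vec_def spatial_def power2_eq_square)

lemma kt_metric_quadratic_form:
  "v \<bullet> (kt_metric m p *v v) =
     m\<^sup>2 * (spatial v \<bullet> spatial v) / (spatial p \<bullet> spatial p)
      - (spatial p \<bullet> spatial p) * (v $ None)\<^sup>2 / m\<^sup>2"
proof -
  have "v \<bullet> (kt_metric m p *v v) = (\<Sum>a\<in>UNIV. kt_coeff m a p * (v $ a)\<^sup>2)"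
    by (simp add: kt_metric_diagonal inner_vec_def matrix_vector_mult_def power2_eq_square
        if_distrib [where f = "\<lambda>x. x * _"] cong: if_cong) (simp add: mult_ac)
  then show ?thesis
    by (simp add: sum_option_UNIV kt_coeff_def inner_spatial_self [of v] sum_distrib_left
        sum_divide_distrib)
qed

text \<open>The null condition expresses \<open>(v $ None)\<^sup>2\<close> through \<open>w\<close>
  (fact \<open>N\<close>). The \<open>T\<close> term of \<open>B\<close> then equals its spatial
  term, which doubles it, and division by \<open>2 * kt_coeff m (Some k) p\<close> cancels every
  power of \<open>m\<close>.\<close>

lemma kt_christoffel_spatial_null:
  assumes m: "m \<noteq> 0" and p: "spatial p \<noteq> 0"
    and null: "v \<bullet> (kt_metric m p *v v) = 0"
  shows "(\<Sum>i\<in>UNIV. \<Sum>j\<in>UNIV. christoffel (kt_metric m) p (Some k) i j * v $ i * v $ j) =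
    2 * (spatial v \<bullet> spatial v) / (spatial p \<bullet> spatial p) * p $ Some k
      - 2 * (spatial p \<bullet> spatial v) / (spatial p \<bullet> spatial p) * v $ Some k"
proof -
  define r2 where "r2 = spatial p \<bullet> spatial p"
  define w where "w = spatial v \<bullet> spatial v"
  define b where "b = spatial p \<bullet> spatial v"
  have r2: "r2 \<noteq> 0" using p by (simp add: r2_def)
  have nz: "kt_coeff m a p \<noteq> 0" for a
    using m p by (auto simp: kt_coeff_def split: option.splits)
  have pk: "spatial p \<bullet> spatial (axis (Some k) 1) = p $ Some k"
    by (simp add: spatial_axis_Some inner_axis) (simp add: spatial_def)
  have A: "(\<Sum>i\<in>UNIV. partial i (kt_coeff m (Some k)) p * v $ i) = - (2 * m\<^sup>2 * b / r2\<^sup>2)"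
    using sum_spatial_axis [of "spatial p" v] p
    by (simp add: partial_kt_coeff sum_negf b_def r2_def
        sum_divide_distrib [symmetric] sum_distrib_left [symmetric] mult.assoc)
  have B: "(\<Sum>i\<in>UNIV. partial (Some k) (kt_coeff m i) p * (v $ i)\<^sup>2)
      = - (2 * p $ Some k * (v $ None)\<^sup>2 / m\<^sup>2) - 2 * m\<^sup>2 * p $ Some k * w / r2\<^sup>2"
    using p unfolding w_def inner_spatial_self [of v]
    by (simp add: sum_option_UNIV partial_kt_coeff pk sum_negf r2_def sum_distrib_left
        sum_divide_distrib)
  have N: "(v $ None)\<^sup>2 = m ^ 4 * w / r2\<^sup>2"
    using null r2 m unfolding kt_metric_quadratic_form r2_def [symmetric] w_def [symmetric]
    by (simp add: field_simps power2_eq_square power4_eq_xxxx)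
  have "(\<Sum>i\<in>UNIV. \<Sum>j\<in>UNIV. christoffel (kt_metric m) p (Some k) i j * v $ i * v $ j) =
    2 * w / r2 * p $ Some k - 2 * b / r2 * v $ Some k"
    unfolding christoffel_diagonal_contraction [of "kt_metric m" "kt_coeff m", OF kt_metric_diagonal nz]
      A B N
    using r2 m
    by (simp add: kt_coeff_def r2_def [symmetric] field_simps power2_eq_square power4_eq_xxxx)
  then show ?thesis by (simp add: r2_def w_def b_def)
qed

section \<open>Derivatives with constant square\<close>

text \<open>
  Were the derivative to change sign, the function would have a critical point in between.
\<close>

lemma has_real_derivative_constant_square:
  fixes f f' :: "real \<Rightarrow> real"
  assumes I: "is_interval I"
    and f: "\<And>s. s \<in> I \<Longrightarrow> (f has_real_derivative f' s) (at s)"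
    and K: "\<And>s. s \<in> I \<Longrightarrow> (f' s)\<^sup>2 = K" "K \<noteq> 0"
    and st: "s \<in> I" "t \<in> I"
  shows "f' s = f' t"
proof -
  have *: "f' s = f' t" if st: "s \<in> I" "t \<in> I" "s < t" for s t
  proof (rule ccontr)
    assume "f' s \<noteq> f' t"
    moreover have "(f' s)\<^sup>2 = (f' t)\<^sup>2" using K(1) st by simp
    ultimately have t: "f' t = - f' s" by (simp add: power2_eq_iff)
    have sub: "{s..t} \<subseteq> I"
      using I st unfolding is_interval_1 by (meson atLeastAtMost_iff subsetI)
    have "f' s \<noteq> 0" using K(1) [OF st(1)] K(2) by auto
    then have Kpos: "0 < f' s * f' s"
      by (simp flip: power2_eq_square)
    \<comment> \<open>The factor \<open>f' s\<close> normalises signs: \<open>g\<close> has positive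
      slope at \<open>s\<close> and negative slope at \<open>t\<close>, so its maximum on
      \<open>{s..t}\<close> is attained in the interior.\<close>
    define g where "g u = f u * f' s" for u
    have g: "(g has_real_derivative f' u * f' s) (at u)" if "u \<in> {s..t}" for u
      unfolding g_def using f sub that by (auto intro!: derivative_eq_intros)
    have "continuous_on {s..t} g"
      by (intro continuous_at_imp_continuous_on ballI DERIV_isCont [OF g])
    then obtain u where u: "u \<in> {s..t}" and max: "\<And>y. y \<in> {s..t} \<Longrightarrow> g y \<le> g u"
      using continuous_attains_sup [of "{s..t}" g] st by auto
    have "u \<noteq> s"
    proof
      assume "u = s"
      then obtain d where "d > 0" and d: "\<And>h. 0 < h \<Longrightarrow> h < d \<Longrightarrow> g u < g (u + h)"
        using DERIV_pos_inc_right [OF g [OF u]] Kpos by auto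
      \<comment> \<open>The step is below \<open>d\<close>, and
        \<open>u + min (d / 2) (t - s)\<close> stays in \<open>{s..t}\<close>, where
        \<open>max\<close> applies.\<close>
      then have "g u < g (u + min (d / 2) (t - s))"
        using st by (intro d) auto
      with max [of "u + min (d / 2) (t - s)"] show False
        using \<open>u = s\<close> \<open>d > 0\<close> st by (auto simp: min_def split: if_splits)
    qed
    moreover have "u \<noteq> t"
    proof
      assume "u = t"
      then have "f' u * f' s < 0" using Kpos t by simp
      then obtain d where "d > 0" and d: "\<And>h. 0 < h \<Longrightarrow> h < d \<Longrightarrow> g u < g (u - h)"
        using DERIV_neg_dec_left [OF g [OF u]] by auto
      then have "g u < g (u - min (d / 2) (t - s))"
        using st by (intro d) auto
      with max [of "u - min (d / 2) (t - s)"] show False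
        using \<open>u = t\<close> \<open>d > 0\<close> st by (auto simp: min_def split: if_splits)
    qed
    ultimately have "s < u" "u < t" using u by auto
    then have "f' u * f' s = 0"
      by (intro DERIV_local_max [OF g [OF u], of "min (u - s) (t - u)"] allI impI max) auto
    then have "f' u = 0" using Kpos by auto
    with K(1) [OF subsetD [OF sub u]] K(2) show False by simp
  qed
  show ?thesis
    using * [OF st] * [OF st(2,1)] by (metis linorder_neqE)
qed

section \<open>Curves solving the spatial equation\<close>

text \<open>
  The equation is that of geodesics of the optical metric \<open>|d\<xi>|\<^sup>2 / |\<xi>|\<^sup>4\<close>, the pull-back of the
  flat metric under inversion, in the parameter of constant Euclidean speed.
\<close>

locale inverted_line =
  fixes J :: "real set" and \<xi> v a :: "real \<Rightarrow> 'a::real_inner"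
  assumes interval: "is_interval J"
    and nonzero: "t \<in> J \<Longrightarrow> \<xi> t \<noteq> 0"
    and velocity: "t \<in> J \<Longrightarrow> (\<xi> has_vector_derivative v t) (at t)"
    and acceleration: "t \<in> J \<Longrightarrow> (v has_vector_derivative a t) (at t)"
    and equation: "t \<in> J \<Longrightarrow>
      a t = (2 * (\<xi> t \<bullet> v t) / (\<xi> t \<bullet> \<xi> t)) *\<^sub>R v t - (2 * (v t \<bullet> v t) / (\<xi> t \<bullet> \<xi> t)) *\<^sub>R \<xi> t"
begin

text \<open>Pairing \<open>equation\<close> with \<open>v\<close> makes its two terms cancel, so
  \<open>v\<close> is orthogonal to \<open>a\<close>.\<close>

lemma constant_speed: "\<exists>c. \<forall>t\<in>J. v t \<bullet> v t = c"
proof (rule has_field_derivative_zero_constant)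
  show "convex J"
    using interval by (rule is_interval_convex)
  fix t assume t: "t \<in> J"
  have "((\<lambda>t. v t \<bullet> v t) has_real_derivative v t \<bullet> a t + a t \<bullet> v t) (at t)"
    using acceleration [OF t] unfolding has_real_derivative_iff_has_vector_derivative
    by (intro bounded_bilinear.has_vector_derivative [OF bounded_bilinear_inner])
  moreover have "v t \<bullet> a t + a t \<bullet> v t = 0"
    using nonzero [OF t]
    by (simp add: equation [OF t] inner_diff_left inner_diff_right inner_commute)
  ultimately show "((\<lambda>t. v t \<bullet> v t) has_real_derivative 0) (at t within J)"
    by (simp add: has_field_derivative_at_within)
qed

text \<open>Differentiating \<open>a = (2b/r) v - (2c/r) \<xi>\<close> and substituting for
  \<open>a\<close> again, the \<open>\<xi>\<close> terms cancel and a multiple \<open>k\<close> of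
  \<open>v\<close> remains; computing \<open>|a|^2 = - c k\<close> identifies that multiple.\<close>

lemma third_derivative:
  assumes c: "\<And>t. t \<in> J \<Longrightarrow> v t \<bullet> v t = c" "c \<noteq> 0" and J: "open J" and t: "t \<in> J"
  shows "(a has_vector_derivative - (((norm (a t))\<^sup>2 / c) *\<^sub>R v t)) (at t)"
proof -
  define b where "b u = \<xi> u \<bullet> v u" for u
  define r where "r u = \<xi> u \<bullet> \<xi> u" for u
  have r: "r t \<noteq> 0" using nonzero [OF t] by (simp add: r_def)
  have r': "(r has_real_derivative 2 * b t) (at t)"
    using bounded_bilinear.has_vector_derivative [OF bounded_bilinear_inner
        velocity [OF t] velocity [OF t]]
    by (simp add: r_def [abs_def] b_def has_real_derivative_iff_has_vector_derivative
        inner_commute)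
  have "\<xi> t \<bullet> a t = 2 * (b t)\<^sup>2 / r t - 2 * c"
    using nonzero [OF t] c(1) [OF t]
    by (simp add: equation [OF t] inner_diff_right b_def r_def power2_eq_square)
  then have b': "(b has_real_derivative 2 * (b t)\<^sup>2 / r t - c) (at t)"
    using bounded_bilinear.has_vector_derivative [OF bounded_bilinear_inner
        velocity [OF t] acceleration [OF t]] c(1) [OF t]
    by (simp add: b_def [abs_def] has_real_derivative_iff_has_vector_derivative)
  \<comment> \<open>The terms in \<open>b^2\<close> coming from \<open>b'\<close> and
    \<open>r'\<close> cancel.\<close>
  have f: "((\<lambda>u. 2 * b u / r u) has_real_derivative - (2 * c / r t)) (at t)"
    using r by (auto intro!: derivative_eq_intros b' r' simp: field_simps power2_eq_square)
  have g: "((\<lambda>u. 2 * c / r u) has_real_derivative - (4 * c * b t / (r t)\<^sup>2)) (at t)"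
    using r by (auto intro!: derivative_eq_intros r' simp: field_simps power2_eq_square)
  have eq: "a u = (2 * b u / r u) *\<^sub>R v u - (2 * c / r u) *\<^sub>R \<xi> u" if "u \<in> J" for u
    using equation [OF that] c(1) [OF that] by (simp add: b_def r_def)
  define k where "k = 4 * (b t)\<^sup>2 / (r t)\<^sup>2 - 4 * c / r t"
  have norm_a: "(norm (a t))\<^sup>2 = - (c * k)"
    using r c(1) [OF t]
    unfolding eq [OF t] power2_norm_eq_inner k_def
    by (simp add: inner_diff_left inner_diff_right inner_commute [of "v t" "\<xi> t"]
        b_def [symmetric] r_def [symmetric] field_simps power2_eq_square)
  have "((\<lambda>u. (2 * b u / r u) *\<^sub>R v u - (2 * c / r u) *\<^sub>R \<xi> u) has_vector_derivative
      ((2 * b t / r t) *\<^sub>R a t + (- (2 * c / r t)) *\<^sub>R v t)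
      - ((2 * c / r t) *\<^sub>R v t + (- (4 * c * b t / (r t)\<^sup>2)) *\<^sub>R \<xi> t)) (at t)"
    by (intro has_vector_derivative_diff has_vector_derivative_scaleR f g
        velocity [OF t] acceleration [OF t])
  also have "((2 * b t / r t) *\<^sub>R a t + (- (2 * c / r t)) *\<^sub>R v t)
      - ((2 * c / r t) *\<^sub>R v t + (- (4 * c * b t / (r t)\<^sup>2)) *\<^sub>R \<xi> t) = k *\<^sub>R v t"
    unfolding eq [OF t] k_def
    by (simp add: algebra_simps power2_eq_square) (simp flip: scaleR_add_left)
  \<comment> \<open>\<open>a\<close> is known to equal the differentiated expression only on
    \<open>J\<close>; openness of \<open>J\<close> transfers the derivative.\<close>
  finally have "(a has_vector_derivative k *\<^sub>R v t) (at t)"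
    by (rule has_vector_derivative_transform_within_open [OF _ J t]) (simp add: eq)
  then show ?thesis
    using c(2) by (simp add: norm_a)
qed

end

section \<open>Projected null geodesics and their arc-length parametrisation\<close>

text \<open>Reduces the problem to a curve in Euclidean space: on null vectors, the
  \<open>Some k\<close> components of the geodesic equation are those of the locale's
  \<open>equation\<close>.\<close>

lemma kt_null_geodesic_spatial:
  assumes m: "m \<noteq> 0" and \<eta>: "null_geodesic_on (kt_metric m) kt_domain J \<eta>"
  obtains v a where "inverted_line J (\<lambda>t. spatial (\<eta> t)) v a"
proof -
  have J: "is_interval J" and dom: "\<And>t. t \<in> J \<Longrightarrow> spatial (\<eta> t) \<noteq> 0"
    using \<eta> by (auto simp: null_geodesic_on_def geodesic_on_def kt_domain_def)
  from \<eta> have "\<exists>w d. \<forall>t\<in>J. (\<eta> has_vector_derivative w t) (at t) \<and>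
      (w has_vector_derivative d t) (at t) \<and>
      (\<forall>k. d t $ k + (\<Sum>i\<in>UNIV. \<Sum>j\<in>UNIV.
        christoffel (kt_metric m) (\<eta> t) k i j * w t $ i * w t $ j) = 0)"
    unfolding null_geodesic_on_def geodesic_on_def by (elim conjE)
  then obtain w d where "\<forall>t\<in>J. (\<eta> has_vector_derivative w t) (at t) \<and>
      (w has_vector_derivative d t) (at t) \<and>
      (\<forall>k. d t $ k + (\<Sum>i\<in>UNIV. \<Sum>j\<in>UNIV.
        christoffel (kt_metric m) (\<eta> t) k i j * w t $ i * w t $ j) = 0)"
    by (elim exE)
  then have w: "\<And>t. t \<in> J \<Longrightarrow> (\<eta> has_vector_derivative w t) (at t)"
    and d: "\<And>t. t \<in> J \<Longrightarrow> (w has_vector_derivative d t) (at t)"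
    and geo: "\<And>t k. t \<in> J \<Longrightarrow> d t $ k + (\<Sum>i\<in>UNIV. \<Sum>j\<in>UNIV.
        christoffel (kt_metric m) (\<eta> t) k i j * w t $ i * w t $ j) = 0"
    by simp_all
  \<comment> \<open>Nullity is stated for \<open>vector_derivative\<close>; uniqueness of
    derivatives moves it to the witness \<open>w\<close>.\<close>
  have null: "w t \<bullet> (kt_metric m (\<eta> t) *v w t) = 0" if "t \<in> J" for t
    using \<eta> that vector_derivative_at [OF w [OF that]]
    by (auto simp: null_geodesic_on_def Let_def)
  have "inverted_line J (\<lambda>t. spatial (\<eta> t)) (\<lambda>t. spatial (w t)) (\<lambda>t. spatial (d t))"
  proof
    fix t assume t: "t \<in> J"
    show "((\<lambda>t. spatial (\<eta> t)) has_vector_derivative spatial (w t)) (at t)"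
      "((\<lambda>t. spatial (w t)) has_vector_derivative spatial (d t)) (at t)"
      using w [OF t] d [OF t]
      by (auto intro: bounded_linear.has_vector_derivative [OF bounded_linear_spatial])
    show "spatial (d t) = (2 * (spatial (\<eta> t) \<bullet> spatial (w t)) / (spatial (\<eta> t) \<bullet> spatial (\<eta> t)))
          *\<^sub>R spatial (w t)
        - (2 * (spatial (w t) \<bullet> spatial (w t)) / (spatial (\<eta> t) \<bullet> spatial (\<eta> t)))
          *\<^sub>R spatial (\<eta> t)"
    proof (rule vec_eq_iff [THEN iffD2], rule allI)
      fix k
      have "d t $ Some k =
          2 * (spatial (\<eta> t) \<bullet> spatial (w t)) / (spatial (\<eta> t) \<bullet> spatial (\<eta> t)) * w t $ Some k
          - 2 * (spatial (w t) \<bullet> spatial (w t)) / (spatial (\<eta> t) \<bullet> spatial (\<eta> t)) * \<eta> t $ Some k"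
        using geo [OF t, of "Some k"] kt_christoffel_spatial_null [OF m dom null, OF t t, of k]
        by linarith
      moreover have "spatial p $ k = p $ Some k" for p
        by (simp add: spatial_def)
      ultimately show "spatial (d t) $ k =
          ((2 * (spatial (\<eta> t) \<bullet> spatial (w t)) / (spatial (\<eta> t) \<bullet> spatial (\<eta> t)))
            *\<^sub>R spatial (w t)
          - (2 * (spatial (w t) \<bullet> spatial (w t)) / (spatial (\<eta> t) \<bullet> spatial (\<eta> t)))
            *\<^sub>R spatial (\<eta> t)) $ k"
        by simp
    qed
  qed (fact J dom)+
  then show thesis by (rule that)
qed

theorem mainTheorem3:
  fixes m :: real and I :: "real set" and \<gamma> :: "real \<Rightarrow> spacetime"
  assumes "m > 0"
    and "unparam_null_geodesic_on (kt_metric m) kt_domain I \<gamma>"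
    and "arc_length_param_on I (\<lambda>s. spatial (\<gamma> s))"
  shows "conformal_circle_on I (\<lambda>s. spatial (\<gamma> s))"
proof (cases "I = {}")
  case True
  then show ?thesis by (simp add: conformal_circle_on_def arc_length_param_on_def)
next
  case False
  \<comment> \<open>The base point yields \<open>c \<noteq> 0\<close> and supplies the constant
    value of \<open>deriv \<phi>\<close>.\<close>
  then obtain s0 where s0: "s0 \<in> I" by blast
  from assms(2) obtain J \<eta> \<phi> where I: "open I" "is_interval I"
    and \<eta>: "null_geodesic_on (kt_metric m) kt_domain J \<eta>" and J: "\<phi> ` I = J"
    and \<phi>: "\<And>s. s \<in> I \<Longrightarrow> \<phi> differentiable (at s)"
    and \<gamma>: "\<And>s. s \<in> I \<Longrightarrow> \<gamma> s = \<eta> (\<phi> s)"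
    unfolding unparam_null_geodesic_on_def by blast
  from kt_null_geodesic_spatial [OF _ \<eta>] assms(1) obtain v a
    where "inverted_line J (\<lambda>t. spatial (\<eta> t)) v a" by auto
  then interpret inverted_line J "\<lambda>t. spatial (\<eta> t)" v a .
  have "open J"
    using \<eta> by (simp add: null_geodesic_on_def geodesic_on_def)
  obtain c where c: "\<And>t. t \<in> J \<Longrightarrow> v t \<bullet> v t = c"
    using constant_speed by blast
  have \<phi>J: "\<phi> s \<in> J" if "s \<in> I" for s using J that by blast
  have \<phi>': "(\<phi> has_real_derivative deriv \<phi> s) (at s)" if "s \<in> I" for s
    using \<phi> [OF that] by (simp add: DERIV_deriv_iff_real_differentiable)
  have chain: "((\<lambda>s. f (\<phi> s)) has_vector_derivative deriv \<phi> s *\<^sub>R f') (at s)"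
    if "s \<in> I" "(f has_vector_derivative f') (at (\<phi> s))" for f :: "real \<Rightarrow> real ^ 3" and f' s
    using vector_diff_chain_at [OF \<phi>' [OF that(1),
          unfolded has_real_derivative_iff_has_vector_derivative] that(2)]
    by (simp add: o_def)
  have x': "((\<lambda>s. spatial (\<gamma> s)) has_vector_derivative deriv \<phi> s *\<^sub>R v (\<phi> s)) (at s)"
    if s: "s \<in> I" for s
    by (rule has_vector_derivative_transform_within_open
        [OF chain [OF s velocity [OF \<phi>J [OF s]]] I(1) s])
       (simp add: \<gamma>)
  have speed: "(deriv \<phi> s)\<^sup>2 * c = 1" if s: "s \<in> I" for s
  proof -
    have "norm (deriv \<phi> s *\<^sub>R v (\<phi> s)) = 1"
      using assms(3) s unfolding vector_derivative_at [OF x' [OF s], symmetric]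
      by (simp add: arc_length_param_on_def)
    then have "(norm (deriv \<phi> s *\<^sub>R v (\<phi> s)))\<^sup>2 = 1" by simp
    then show ?thesis
      using c [OF \<phi>J [OF s]] by (simp add: power2_norm_eq_inner power_mult_distrib)
  qed
  have c0: "c \<noteq> 0" using speed [OF s0] by auto
  define k where "k = deriv \<phi> s0"
  \<comment> \<open>The definition gives \<open>\<phi>\<close> one derivative only, with no
    continuity. Constancy of \<open>deriv \<phi>\<close> is what lets the velocity be differentiated
    twice more; \<open>k\<close> may be negative, for a reversed orientation.\<close>
  have k: "deriv \<phi> s = k" if s: "s \<in> I" for s
    unfolding k_def
  proof (rule has_real_derivative_constant_square [OF I(2) \<phi>' _ _ s s0])
    show "(deriv \<phi> u)\<^sup>2 = 1 / c" if "u \<in> I" for u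
      using speed [OF that] c0 by (simp add: field_simps)
    show "1 / c \<noteq> 0" using c0 by simp
  qed
  have kc: "k\<^sup>2 * c = 1" using speed [OF s0] by (simp add: k_def)
  show ?thesis
    unfolding conformal_circle_on_def
  proof (intro conjI exI ballI)
    show "arc_length_param_on I (\<lambda>s. spatial (\<gamma> s))" by fact
    fix s assume s: "s \<in> I"
    note t = \<phi>J [OF s]
    show "((\<lambda>s. spatial (\<gamma> s)) has_vector_derivative k *\<^sub>R v (\<phi> s)) (at s)"
      using x' [OF s] by (simp add: k [OF s])
    have "((\<lambda>s. k *\<^sub>R v (\<phi> s)) has_vector_derivative k *\<^sub>R k *\<^sub>R a (\<phi> s)) (at s)"
      using bounded_linear.has_vector_derivative [OF bounded_linear_scaleR_right
          chain [OF s acceleration [OF t]]] by (simp add: k [OF s])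
    then show "((\<lambda>s. k *\<^sub>R v (\<phi> s)) has_vector_derivative k\<^sup>2 *\<^sub>R a (\<phi> s)) (at s)"
      by (simp add: power2_eq_square)
    show "((\<lambda>s. k\<^sup>2 *\<^sub>R a (\<phi> s)) has_vector_derivative
        k\<^sup>2 *\<^sub>R k *\<^sub>R - (((norm (a (\<phi> s)))\<^sup>2 / c) *\<^sub>R v (\<phi> s))) (at s)"
      using bounded_linear.has_vector_derivative [OF bounded_linear_scaleR_right
          chain [OF s third_derivative [OF c c0 \<open>open J\<close> t]]] by (simp add: k [OF s])
    \<comment> \<open>Both sides become \<open>-k^5 |a|^2 v\<close> once \<open>1 / c\<close> is
      replaced by \<open>k^2\<close>.\<close>
    have "1 / c = k\<^sup>2" using kc c0 by (simp add: field_simps)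
    then show "k\<^sup>2 *\<^sub>R k *\<^sub>R - (((norm (a (\<phi> s)))\<^sup>2 / c) *\<^sub>R v (\<phi> s)) =
        - ((norm (k\<^sup>2 *\<^sub>R a (\<phi> s)))\<^sup>2 *\<^sub>R k *\<^sub>R v (\<phi> s))"
      by (simp add: divide_inverse power_mult_distrib power2_eq_square mult_ac)
  qed
qed

end
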